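(* Let $c > 1/2$ and let $p > 0$ be a constant. Any randomized algorithm that, for every undirected graph on vertex set $[n]$ with non-negative edge weights, outputs a set $T \subseteq [n]$ with $F(T) \ge c \max_{S \subseteq [n]} F(S)$ with probability at least $p$ must make at least $\frac{n}{\log n}\left(\frac{p(2c-1)}{16c+72} - o(1)\right)$ cut queries (with $o(1) \to 0$ as $n \to \infty$). This holds even when the inputs are restricted to unweighted graphs (all edge weights in $\{0,1\}$); in particular the randomized query complexity of $c$-approximate max-cut in the cut finding setting with constant success probability is $\Omega(n/\log n)$.
   Context: Cut query model: an undirected graph $G$ on $[n]$ has non-negative edge weights $w_{i,j}$ and cut function $F(S) = \sum_{i \in S, j \notin S} w_{i,j}$. An algorithm accesses $G$ only by submitting sets $S \subseteq [n]$ and receiving $F(S)$ (adaptively, with unlimited computation and internal randomness); query complexity is the number of queries. The cut finding setting means the algorithm must output a set $T$ (not merely a value). *)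

theory Defs
  imports "HOL-Probability.Probability"
begin

text \<open>A graph on the vertex set \<open>{1..n}\<close> is given by its weight function; values of \<open>w\<close> outside
  \<open>{1..n}\<close> are unconstrained and never used.\<close>

type_synonym weights = "nat \<Rightarrow> nat \<Rightarrow> real"

definition weighted_graphs :: "nat \<Rightarrow> weights set" where
  "weighted_graphs n =
     {w. (\<forall>i\<in>{1..n}. \<forall>j\<in>{1..n}. w i j = w j i \<and> 0 \<le> w i j) \<and> (\<forall>i\<in>{1..n}. w i i = 0)}"

definition unweighted_graphs :: "nat \<Rightarrow> weights set" where
  "unweighted_graphs n =
     {w \<in> weighted_graphs n. \<forall>i\<in>{1..n}. \<forall>j\<in>{1..n}. w i j \<in> {0, 1}}"

definition cut :: "nat \<Rightarrow> weights \<Rightarrow> nat set \<Rightarrow> real" where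
  "cut n w S = (\<Sum>i\<in>S. \<Sum>j\<in>{1..n} - S. w i j)"

definition max_cut :: "nat \<Rightarrow> weights \<Rightarrow> real" where
  "max_cut n w = Max (cut n w ` Pow {1..n})"

text \<open>A deterministic adaptive algorithm is a decision tree: it either stops and outputs a set, or
  queries a set and continues depending on the real number it receives. Every run is finite, but
  the number of queries need not be bounded uniformly over the answers.\<close>

datatype qtree = Output "nat set" | Query "nat set" "real \<Rightarrow> qtree"

primrec valid_tree :: "nat \<Rightarrow> qtree \<Rightarrow> bool" where
  "valid_tree n (Output T) \<longleftrightarrow> T \<subseteq> {1..n}"
| "valid_tree n (Query S k) \<longleftrightarrow> S \<subseteq> {1..n} \<and> (\<forall>r. valid_tree n (k r))"

primrec run_tree :: "qtree \<Rightarrow> (nat set \<Rightarrow> real) \<Rightarrow> nat set" where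
  "run_tree (Output T) F = T"
| "run_tree (Query S k) F = run_tree (k (F S)) F"

primrec num_queries :: "qtree \<Rightarrow> (nat set \<Rightarrow> real) \<Rightarrow> nat" where
  "num_queries (Output T) F = 0"
| "num_queries (Query S k) F = Suc (num_queries (k (F S)) F)"

text \<open>A randomized algorithm is a probability distribution on decision trees, over an arbitrary
  sigma-algebra. This covers arbitrary internal randomness: an algorithm given by a map from a
  probability space of random seeds to trees is represented by its pushforward (with the largest
  sigma-algebra making the map measurable).\<close>

definition randomized_alg :: "nat \<Rightarrow> qtree measure \<Rightarrow> bool" where
  "randomized_alg n A \<longleftrightarrow> prob_space A \<and> (\<forall>t\<in>space A. valid_tree n t)"

text \<open>The measure of a non-measurable set is \<open>0\<close>, so for \<open>p > 0\<close> the following also demands that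
  the success events are measurable.\<close>

definition finds_cut :: "weights set \<Rightarrow> nat \<Rightarrow> real \<Rightarrow> real \<Rightarrow> qtree measure \<Rightarrow> bool" where
  "finds_cut \<G> n c p A \<longleftrightarrow>
     (\<forall>w\<in>\<G>. measure A {t \<in> space A. cut n w (run_tree t (cut n w)) \<ge> c * max_cut n w} \<ge> p)"

definition makes_at_most :: "weights set \<Rightarrow> nat \<Rightarrow> qtree measure \<Rightarrow> nat \<Rightarrow> bool" where
  "makes_at_most \<G> n A q \<longleftrightarrow> (\<forall>w\<in>\<G>. AE t in A. num_queries t (cut n w) \<le> q)"

text \<open>The value is \<open>\<infinity>\<close> if no algorithm with a finite worst-case number of queries exists.\<close>

definition query_complexity :: "weights set \<Rightarrow> nat \<Rightarrow> real \<Rightarrow> real \<Rightarrow> enat" where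
  "query_complexity \<G> n c p =
     Inf {enat q | q. \<exists>A. randomized_alg n A \<and> finds_cut \<G> n c p A \<and> makes_at_most \<G> n A q}"

end

theory Submission
  imports Defs "HOL-Real_Asymp.Real_Asymp"
begin

text \<open>
  Hide a uniformly random balanced bipartition in its complete bipartite graph. Writing the planted
  side \<open>S\<close> and a set \<open>T\<close> as sign vectors \<open>x, y\<close>, the cut value of \<open>T\<close> is
  \<open>(n\<^sup>2 - (\<Sum>x)\<^sup>2 - (\<Sum>y)\<^sup>2 + (\<Sum>xy)\<^sup>2) / 8\<close>, so every \<open>c\<close>-approximate cut has
  \<open>(\<Sum>xy)\<^sup>2 \<ge> (2c - 1)(n\<^sup>2 - 1)\<close>; by a Chernoff bound this holds, for fixed \<open>T\<close>, for at most a
  fraction \<open>2 exp (- (2c - 1)(n\<^sup>2 - 1) / (2n))\<close> of all \<open>S\<close>. Cut values are integers in \<open>[0, n\<^sup>2]\<close>,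
  so a decision tree with \<open>q\<close> queries has at most \<open>(n\<^sup>2 + 1)^q\<close> outputs, and a union bound over them
  yields \<open>q \<ge> (n / ln n) ((2c - 1) / 6 - o(1))\<close>. This exceeds the claimed bound because \<open>p \<le> 1\<close>.
\<close>

section \<open>Cuts of a planted complete bipartite graph\<close>

definition sign_vec :: "nat set \<Rightarrow> nat \<Rightarrow> real" where
  "sign_vec S i = (if i \<in> S then 1 else - 1)"

definition bipartite_graph :: "nat set \<Rightarrow> weights" where
  "bipartite_graph S i j = (if (i \<in> S) = (j \<in> S) then 0 else 1)"

lemma bipartite_graph_unweighted: "bipartite_graph S \<in> unweighted_graphs n"
  by (auto simp: bipartite_graph_def unweighted_graphs_def weighted_graphs_def)

text \<open>With signs \<open>x\<close> and \<open>y\<close>, the conditions that \<open>i\<close>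
  lies in \<open>T\<close>, that \<open>j\<close> does not, and that the planted bipartition
  separates them have indicators \<open>(1 + y i) / 2\<close>, \<open>(1 - y j) / 2\<close> and
  \<open>(1 - x i * x j) / 2\<close>. In the expanded double sum the terms linear and cubic in the
  signs cancel under swapping \<open>i\<close> and \<open>j\<close>.\<close>

lemma cut_bipartite_graph:
  assumes "T \<subseteq> {1..n}"
  shows "cut n (bipartite_graph S) T =
    ((real n)\<^sup>2 - (\<Sum>i=1..n. sign_vec S i)\<^sup>2 - (\<Sum>i=1..n. sign_vec T i)\<^sup>2
      + (\<Sum>i=1..n. sign_vec S i * sign_vec T i)\<^sup>2) / 8"
proof -
  define x y where "x = sign_vec S" and "y = sign_vec T"
  have "cut n (bipartite_graph S) T
      = (\<Sum>i=1..n. \<Sum>j=1..n. (1 + y i) / 2 * ((1 - y j) / 2) * ((1 - x i * x j) / 2))"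
  proof -
    have "cut n (bipartite_graph S) T
        = (\<Sum>i\<in>T. \<Sum>j=1..n. (1 + y i) / 2 * ((1 - y j) / 2) * ((1 - x i * x j) / 2))"
      unfolding cut_def
      by (intro sum.cong refl sum.mono_neutral_cong_left)
        (auto simp: x_def y_def sign_vec_def bipartite_graph_def)
    also have "\<dots> = (\<Sum>i=1..n. \<Sum>j=1..n. (1 + y i) / 2 * ((1 - y j) / 2) * ((1 - x i * x j) / 2))"
      using assms by (intro sum.mono_neutral_left) (auto simp: y_def sign_vec_def)
    finally show ?thesis .
  qed
  also have "\<dots> = (\<Sum>i=1..n. \<Sum>j=1..n. 1 + y i - y j - y i * y j - x i * x j - (x i * y i) * x j
      + x i * (x j * y j) + (x i * y i) * (x j * y j)) / 8"
    unfolding sum_divide_distrib by (intro sum.cong refl) (simp add: field_simps)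
  also have "\<dots> = ((real n)\<^sup>2 - (\<Sum>i=1..n. x i)\<^sup>2 - (\<Sum>i=1..n. y i)\<^sup>2 + (\<Sum>i=1..n. x i * y i)\<^sup>2) / 8"
    unfolding sum.distrib sum_subtractf sum_product[symmetric]
    by (simp add: power2_eq_square flip: sum_distrib_left)
  finally show ?thesis by (simp add: x_def y_def)
qed

lemma sum_sign_vec:
  assumes "S \<subseteq> {1..n}"
  shows "(\<Sum>i=1..n. sign_vec S i) = 2 * real (card S) - real n"
proof -
  have "(\<Sum>i=1..n. sign_vec S i) = (\<Sum>i=1..n. 2 * indicator S i - 1)"
    by (intro sum.cong) (auto simp: sign_vec_def)
  also have "\<dots> = 2 * real (card ({1..n} \<inter> S)) - real n"
    by (simp add: sum_subtractf indicator_def sum.If_cases Collect_mem_eq flip: sum_distrib_left)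
  also have "{1..n} \<inter> S = S" using assms by auto
  finally show ?thesis .
qed

text \<open>The planted cut has value \<open>(n^2 - X^2) / 4\<close>, twice what the formula for
  \<open>T\<close> gives without its correlation term. A factor \<open>c > 1/2\<close> thus leaves a
  surplus that only the correlation can supply.\<close>

lemma approx_cut_correlated:
  assumes "S \<subseteq> {1..n}" "card S = n div 2" "T \<subseteq> {1..n}" "c > 1 / 2"
    and approx: "cut n (bipartite_graph S) T \<ge> c * max_cut n (bipartite_graph S)"
  shows "(\<Sum>i=1..n. sign_vec S i * sign_vec T i)\<^sup>2 \<ge> (2 * c - 1) * ((real n)\<^sup>2 - 1)"
proof -
  define X where "X = (\<Sum>i=1..n. sign_vec S i)"
  \<comment> \<open>Balance makes \<open>X\<close> equal to 0 for even \<open>n\<close> and -1 for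
    odd \<open>n\<close>; this is the source of the \<open>- 1\<close> in the bound.\<close>
  have "2 * (n div 2) = n \<or> 2 * (n div 2) + 1 = n" by presburger
  hence "2 * real (n div 2) = real n \<or> 2 * real (n div 2) + 1 = real n" by linarith
  hence X: "X\<^sup>2 \<le> 1"
    using sum_sign_vec[OF assms(1)] assms(2) by (simp add: X_def abs_square_le_1)
  have "cut n (bipartite_graph S) S = ((real n)\<^sup>2 - X\<^sup>2) / 4"
  proof -
    have "(\<Sum>i=1..n. sign_vec S i * sign_vec S i) = (\<Sum>i=1..n. 1)"
      by (intro sum.cong) (auto simp: sign_vec_def)
    thus ?thesis
      by (simp add: cut_bipartite_graph[OF assms(1)] X_def)
  qed
  moreover have "cut n (bipartite_graph S) S \<le> max_cut n (bipartite_graph S)"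
    unfolding max_cut_def using assms(1) by (intro Max_ge) auto
  ultimately have "c * (((real n)\<^sup>2 - X\<^sup>2) / 4) \<le> c * max_cut n (bipartite_graph S)"
    using assms(4) by (intro mult_left_mono) auto
  with approx have "c * (((real n)\<^sup>2 - X\<^sup>2) / 4) \<le> cut n (bipartite_graph S) T" by linarith
  hence "2 * c * ((real n)\<^sup>2 - X\<^sup>2) \<le> (real n)\<^sup>2 - X\<^sup>2 - (\<Sum>i=1..n. sign_vec T i)\<^sup>2
      + (\<Sum>i=1..n. sign_vec S i * sign_vec T i)\<^sup>2"
    unfolding cut_bipartite_graph[OF assms(3)] X_def[symmetric] by simp
  moreover have "(\<Sum>i=1..n. sign_vec T i)\<^sup>2 \<ge> 0" by simp
  moreover have "(2 * c - 1) * ((real n)\<^sup>2 - 1) \<le> (2 * c - 1) * ((real n)\<^sup>2 - X\<^sup>2)"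
    using X assms(4) by (intro mult_left_mono) auto
  moreover have "(2 * c - 1) * ((real n)\<^sup>2 - X\<^sup>2) = 2 * c * ((real n)\<^sup>2 - X\<^sup>2) - ((real n)\<^sup>2 - X\<^sup>2)"
    by (simp add: algebra_simps)
  ultimately show ?thesis by linarith
qed

section \<open>A Chernoff bound for correlations of sign vectors\<close>

text \<open>This is cosh l \<le> exp(l^2/2), the moment bound for a fair sign. It follows from the
  analytic core of Hoeffding's lemma at success probability 1/2 and width \<open>2 * l\<close>,
  recentred by the factor \<open>exp (- l)\<close>; evenness covers negative
  \<open>l\<close>.\<close>

lemma exp_add_exp_minus_le: "exp l + exp (- l) \<le> 2 * exp (l\<^sup>2 / 2)" for l :: real
proof -
  have *: "exp l + exp (- l) \<le> 2 * exp (l\<^sup>2 / 2)" if "l \<ge> 0" for l :: real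
  proof -
    have pos: "1 + (1 / 2) * (exp (2 * l) - 1) = (exp (2 * l) + 1) / 2" by (simp add: field_simps)
    have "- (2 * l) * (1 / 2) + ln (1 + (1 / 2) * (exp (2 * l) - 1)) \<le> (2 * l)\<^sup>2 / 8"
      using that by (intro Hoeffdings_lemma_aux) auto
    hence "ln ((exp (2 * l) + 1) / 2) \<le> l + l\<^sup>2 / 2"
      unfolding pos by (simp add: power2_eq_square)
    hence "(exp (2 * l) + 1) / 2 \<le> exp (l + l\<^sup>2 / 2)"
      by (subst ln_le_cancel_iff[symmetric]) (auto intro: add_pos_pos)
    hence "exp (- l) * (exp (2 * l) + 1) \<le> exp (- l) * (2 * exp (l + l\<^sup>2 / 2))"
      by (intro mult_left_mono) auto
    thus ?thesis
      by (simp add: algebra_simps flip: exp_add)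
  qed
  show ?thesis using *[of l] *[of "- l"] by (cases "l \<ge> 0") auto
qed

text \<open>Up to the factor \<open>2 ^ n\<close> this is the moment generating function of the
  correlation for uniform \<open>S\<close>. Each element is independently in or out of
  \<open>S\<close>, so the sum over subsets is an expanded product; every factor is
  \<open>exp l + exp (- l)\<close>, whatever the sign of \<open>T\<close>.\<close>

lemma sum_exp_correlation_le:
  "(\<Sum>S\<in>Pow {1..n}. exp (l * (\<Sum>i=1..n. sign_vec S i * sign_vec T i)))
    \<le> 2 ^ n * exp (real n * l\<^sup>2 / 2)"
proof -
  have "(\<Sum>S\<in>Pow {1..n}. exp (l * (\<Sum>i=1..n. sign_vec S i * sign_vec T i)))
      = (\<Sum>S\<in>Pow {1..n}. (\<Prod>i\<in>S. exp (l * sign_vec T i)) * (\<Prod>i\<in>{1..n} - S. exp (- l * sign_vec T i)))"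
  proof (intro sum.cong refl)
    fix S assume S: "S \<in> Pow {1..n}"
    have "(\<Sum>i=1..n. sign_vec S i * sign_vec T i)
        = (\<Sum>i\<in>{1..n} - S. sign_vec S i * sign_vec T i) + (\<Sum>i\<in>S. sign_vec S i * sign_vec T i)"
      using S by (intro sum.subset_diff) auto
    also have "\<dots> = (\<Sum>i\<in>{1..n} - S. - sign_vec T i) + (\<Sum>i\<in>S. sign_vec T i)"
      by (intro arg_cong2[of _ _ _ _ "(+)"] sum.cong) (auto simp: sign_vec_def)
    finally have "l * (\<Sum>i=1..n. sign_vec S i * sign_vec T i)
        = (\<Sum>i\<in>S. l * sign_vec T i) + (\<Sum>i\<in>{1..n} - S. - l * sign_vec T i)"
      by (simp add: right_diff_distrib sum_negf flip: sum_distrib_left)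
    moreover have "finite S" using S by (auto intro: finite_subset)
    ultimately show "exp (l * (\<Sum>i=1..n. sign_vec S i * sign_vec T i))
        = (\<Prod>i\<in>S. exp (l * sign_vec T i)) * (\<Prod>i\<in>{1..n} - S. exp (- l * sign_vec T i))"
      by (simp only: exp_add exp_sum finite_Diff finite_atLeastAtMost)
  qed
  also have "\<dots> = (\<Prod>i=1..n. exp (l * sign_vec T i) + exp (- l * sign_vec T i))"
    by (intro prod_add[symmetric]) auto
  also have "\<dots> \<le> (\<Prod>i=1..n. 2 * exp (l\<^sup>2 / 2))"
    using exp_add_exp_minus_le[of l]
    by (intro prod_mono) (auto simp: sign_vec_def add.commute)
  also have "\<dots> = 2 ^ n * exp (real n * l\<^sup>2 / 2)"
    by (simp add: power_mult_distrib flip: exp_of_nat_mult)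
  finally show ?thesis .
qed

text \<open>Markov's inequality for the exponential moments at \<open>l\<close> and
  \<open>- l\<close>, one for each tail. All subsets are counted, not only balanced ones, so that
  the coordinates stay independent.\<close>

lemma card_correlated_le:
  assumes "n > 0" "a \<ge> 0"
  shows "real (card {S \<in> Pow {1..n}. (\<Sum>i=1..n. sign_vec S i * sign_vec T i)\<^sup>2 \<ge> a})
    \<le> 2 * 2 ^ n * exp (- a / (2 * real n))"
proof -
  define t where "t = sqrt a"
  \<comment> \<open>This choice minimizes the exponent \<open>n * l^2 / 2 - l * t\<close>.\<close>
  define l where "l = t / real n"
  define Z where "Z S = (\<Sum>i=1..n. sign_vec S i * sign_vec T i)" for S
  define B where "B = {S \<in> Pow {1..n}. (Z S)\<^sup>2 \<ge> a}"
  have a: "a = t\<^sup>2" and t: "t \<ge> 0" using assms by (auto simp: t_def)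
  have l: "l \<ge> 0" using t by (simp add: l_def)
  have "real (card B) * exp (l * t) = (\<Sum>S\<in>B. exp (l * t))" by simp
  also have "\<dots> \<le> (\<Sum>S\<in>B. exp (l * Z S) + exp (- l * Z S))"
  proof (intro sum_mono)
    fix S assume "S \<in> B"
    hence "t \<le> \<bar>Z S\<bar>" using t by (auto simp: B_def a abs_le_square_iff[symmetric])
    hence "l * t \<le> l * Z S \<or> l * t \<le> - l * Z S"
      using mult_left_mono[OF _ l, of t "Z S"] mult_left_mono[OF _ l, of t "- Z S"] by linarith
    thus "exp (l * t) \<le> exp (l * Z S) + exp (- l * Z S)"
      by (smt (verit) exp_gt_zero exp_le_cancel_iff)
  qed
  also have "\<dots> \<le> (\<Sum>S\<in>Pow {1..n}. exp (l * Z S) + exp (- l * Z S))"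
    by (intro sum_mono2) (auto simp: B_def add_nonneg_nonneg)
  also have "\<dots> \<le> 2 ^ n * exp (real n * l\<^sup>2 / 2) + 2 ^ n * exp (real n * (- l)\<^sup>2 / 2)"
    unfolding sum.distrib Z_def by (intro add_mono sum_exp_correlation_le)
  finally have "real (card B) * exp (l * t) * exp (- (l * t))
      \<le> (2 * 2 ^ n * exp (real n * l\<^sup>2 / 2)) * exp (- (l * t))"
    by (intro mult_right_mono) auto
  also have "(2 * 2 ^ n * exp (real n * l\<^sup>2 / 2)) * exp (- (l * t))
      = 2 * 2 ^ n * exp (real n * l\<^sup>2 / 2 - l * t)"
    by (simp add: mult_exp_exp)
  also have "real n * l\<^sup>2 / 2 - l * t = - a / (2 * real n)"
    using assms by (simp add: l_def a power2_eq_square field_simps)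
  finally show ?thesis by (simp add: B_def Z_def mult.assoc flip: exp_add)
qed

section \<open>Counting outputs and fixing the randomness\<close>

text \<open>The first answer lies in \<open>R\<close> and so selects one of \<open>card R\<close>
  subtrees, each left with one query less. Restricting to runs within the budget matters because
  trees branch over all reals and may have unbounded depth.\<close>

lemma card_tree_outputs_le:
  assumes "finite R" "R \<noteq> {}" "valid_tree n t"
    and "\<And>F S. F \<in> \<F> \<Longrightarrow> S \<subseteq> {1..n} \<Longrightarrow> F S \<in> R"
  shows "finite (run_tree t ` {F \<in> \<F>. num_queries t F \<le> q}) \<and>
    card (run_tree t ` {F \<in> \<F>. num_queries t F \<le> q}) \<le> card R ^ q"
  using assms(3)
proof (induction t arbitrary: q)
  case (Output T)
  have sub: "run_tree (Output T) ` {F \<in> \<F>. num_queries (Output T) F \<le> q} \<subseteq> {T}" by auto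
  have "1 \<le> card R ^ q" using assms(1,2) by (simp add: Suc_le_eq card_gt_0_iff)
  thus ?case
    using finite_subset[OF sub] card_mono[OF _ sub] by simp
next
  case (Query S k)
  show ?case
  proof (cases q)
    \<comment> \<open>No run through a query node fits a zero budget, so the image is empty.\<close>
    case 0
    thus ?thesis by simp
  next
    case (Suc r)
    let ?A = "\<lambda>v. run_tree (k v) ` {F \<in> \<F>. num_queries (k v) F \<le> r}"
    have sub: "run_tree (Query S k) ` {F \<in> \<F>. num_queries (Query S k) F \<le> q} \<subseteq> (\<Union>v\<in>R. ?A v)"
      using Query.prems assms(4) by (auto simp: Suc)
    have IH: "finite (?A v) \<and> card (?A v) \<le> card R ^ r" for v
      using Query.prems by (intro Query.IH) auto
    have "card (\<Union>v\<in>R. ?A v) \<le> (\<Sum>v\<in>R. card (?A v))"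
      by (intro card_UN_le assms)
    also have "\<dots> \<le> (\<Sum>v\<in>R. card R ^ r)" using IH by (intro sum_mono) auto
    finally have "card (\<Union>v\<in>R. ?A v) \<le> card R ^ q" by (simp add: Suc)
    moreover have fin: "finite (\<Union>v\<in>R. ?A v)" using IH assms(1) by blast
    ultimately show ?thesis
      using finite_subset[OF sub fin] card_mono[OF fin sub] by linarith
  qed
qed

text \<open>Averaging, as in the easy direction of Yao's principle: the expected number of
  successful inputs is at least \<open>p * card I\<close>, and some outcome reaches it. As
  \<open>I\<close> is finite, the almost sure properties \<open>Q i\<close> hold simultaneously
  almost surely.\<close>

lemma (in prob_space) ex_outcome_card_ge:
  assumes "finite I" "p > 0"
    and prob: "\<And>i. i \<in> I \<Longrightarrow> prob {x \<in> space M. P i x} \<ge> p"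
    and ae: "\<And>i. i \<in> I \<Longrightarrow> AE x in M. Q i x"
  shows "\<exists>x\<in>space M. p * real (card I) \<le> real (card {i \<in> I. P i x \<and> Q i x})"
proof (rule ccontr)
  assume neg: "\<not> ?thesis"
  define E where "E i = {x \<in> space M. P i x}" for i
  \<comment> \<open>A non-measurable set would have measure 0, below \<open>p\<close>.\<close>
  have E: "E i \<in> events" if "i \<in> I" for i
    using prob[OF that] \<open>p > 0\<close> measure_notin_sets[of "E i" M] by (force simp: E_def)
  define f where "f x = (\<Sum>i\<in>I. indicator (E i) x :: real)" for x
  have "AE x in M. \<forall>i\<in>I. Q i x" using ae assms(1) by (simp add: AE_finite_all)
  hence "AE x in M. f x < p * real (card I)"
  proof (rule AE_mp, intro AE_I2 impI)
    fix x assume x: "x \<in> space M" "\<forall>i\<in>I. Q i x"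
    have "f x = real (card (I \<inter> {i. x \<in> E i}))"
      using assms(1) by (simp add: f_def indicator_def sum.If_cases)
    also have "I \<inter> {i. x \<in> E i} = {i \<in> I. P i x \<and> Q i x}" using x by (auto simp: E_def)
    finally show "f x < p * real (card I)" using neg x(1) by auto
  qed
  moreover have int: "integrable M (indicator (E i) :: _ \<Rightarrow> real)" if "i \<in> I" for i
    using E[OF that] by (simp add: emeasure_eq_measure)
  ultimately have "expectation f < p * real (card I)"
    unfolding f_def by (intro expectation_less) auto
  moreover have "expectation f = (\<Sum>i\<in>I. prob (E i))"
    unfolding f_def using int E by (subst Bochner_Integration.integral_sum) auto
  moreover have "(\<Sum>i\<in>I. prob (E i)) \<ge> (\<Sum>i\<in>I. p)"
    using prob by (intro sum_mono) (auto simp: E_def)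
  ultimately show False by (simp add: mult.commute)
qed

text \<open>Supplies the finite answer set, of size \<open>n^2 + 1\<close>, for counting tree
  outputs.\<close>

lemma cut_bipartite_graph_in:
  assumes "T \<subseteq> {1..n}"
  shows "cut n (bipartite_graph S) T \<in> real ` {..n\<^sup>2}"
proof -
  define m where "m = (\<Sum>i\<in>T. \<Sum>j\<in>{1..n} - T. if (i \<in> S) = (j \<in> S) then 0 else 1 :: nat)"
  have "m \<le> (\<Sum>i\<in>T. \<Sum>j\<in>{1..n} - T. 1)"
    unfolding m_def by (intro sum_mono) auto
  also have "\<dots> = card T * card ({1..n} - T)" by simp
  also have "\<dots> \<le> card {1..n} * card {1..n}"
    using assms by (intro mult_mono card_mono) auto
  finally have "m \<le> n\<^sup>2" by (simp add: power2_eq_square)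
  moreover have "cut n (bipartite_graph S) T = real m"
    by (auto simp: cut_def m_def bipartite_graph_def intro!: sum.cong)
  ultimately show ?thesis by auto
qed

text \<open>The central coefficient is the largest of the \<open>n + 1\<close> entries of its row.
  The factor \<open>n + 1\<close> is the price of comparing balanced sets with all subsets.\<close>

lemma central_binomial_ge: "2 ^ n \<le> (n + 1) * (n choose (n div 2))"
proof -
  have "2 ^ n = (\<Sum>k\<le>n. n choose k)" by (rule choose_row_sum[symmetric])
  also have "\<dots> \<le> (\<Sum>k\<le>n. n choose (n div 2))" by (intro sum_mono binomial_maximum)
  finally show ?thesis by simp
qed

section \<open>Union bound over the outputs of one tree\<close>

lemma success_bound:
  assumes "c > 1 / 2" "p > 0" "n > 0" "\<And>S. bipartite_graph S \<in> \<G>"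
    and alg: "randomized_alg n A" and finds: "finds_cut \<G> n c p A" and quer: "makes_at_most \<G> n A q"
  shows "p * real (n choose (n div 2))
    \<le> (real n ^ 2 + 1) ^ q * (2 * 2 ^ n * exp (- ((2 * c - 1) * ((real n)\<^sup>2 - 1)) / (2 * real n)))"
proof -
  interpret prob_space A using alg by (simp add: randomized_alg_def)
  define I where "I = {S. S \<subseteq> {1..n} \<and> card S = n div 2}"
  define b where "b = 2 * 2 ^ n * exp (- ((2 * c - 1) * ((real n)\<^sup>2 - 1)) / (2 * real n))"
  define G where "G S = cut n (bipartite_graph S)" for S
  have I: "finite I" "card I = n choose (n div 2)"
    unfolding I_def by (simp_all add: n_subsets)
  \<comment> \<open>Fixes one deterministic tree that succeeds within budget on at least a fraction
    \<open>p\<close> of the balanced sets.\<close>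
  have "\<exists>t\<in>space A. p * real (card I) \<le> real (card {S \<in> I.
      c * max_cut n (bipartite_graph S) \<le> G S (run_tree t (G S)) \<and> num_queries t (G S) \<le> q})"
    using finds quer assms I(1) unfolding finds_cut_def makes_at_most_def G_def
    by (intro ex_outcome_card_ge) auto
  then obtain t where t: "t \<in> space A" and le: "p * real (card I) \<le> real (card {S \<in> I.
      c * max_cut n (bipartite_graph S) \<le> G S (run_tree t (G S)) \<and> num_queries t (G S) \<le> q})"
    (is "_ \<le> real (card ?J)") by blast
  have valid: "valid_tree n t" using alg t by (simp add: randomized_alg_def)
  define B where "B T = {S \<in> Pow {1..n}. (\<Sum>i=1..n. sign_vec S i * sign_vec T i)\<^sup>2
      \<ge> (2 * c - 1) * ((real n)\<^sup>2 - 1)}" for T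
  define Outs where "Outs = run_tree t ` {F \<in> range G. num_queries t F \<le> q}"
  have Outs: "finite Outs" "card Outs \<le> (n\<^sup>2 + 1) ^ q"
  proof -
    have "finite Outs \<and> card Outs \<le> card (real ` {..n\<^sup>2}) ^ q"
      unfolding Outs_def using valid cut_bipartite_graph_in
      by (intro card_tree_outputs_le) (auto simp: G_def)
    thus "finite Outs" "card Outs \<le> (n\<^sup>2 + 1) ^ q"
      by (simp_all add: card_image)
  qed
  have run: "valid_tree n t' \<Longrightarrow> run_tree t' F \<subseteq> {1..n}" for t' F
    by (induction t') auto
  \<comment> \<open>Each success is charged to the output that the tree produces on it.\<close>
  have "?J \<subseteq> (\<Union>T\<in>Outs. B T)"
  proof
    fix S assume S: "S \<in> ?J"
    hence "run_tree t (G S) \<in> Outs" by (auto simp: Outs_def)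
    moreover have "S \<in> B (run_tree t (G S))"
      using S assms(1) approx_cut_correlated[of S n "run_tree t (G S)" c] run[OF valid]
      by (auto simp: B_def I_def G_def)
    ultimately show "S \<in> (\<Union>T\<in>Outs. B T)" by blast
  qed
  moreover have "finite (B T)" for T by (simp add: B_def)
  ultimately have "card ?J \<le> card (\<Union>T\<in>Outs. B T)" using Outs by (intro card_mono) auto
  also have "\<dots> \<le> (\<Sum>T\<in>Outs. card (B T))" by (intro card_UN_le Outs(1))
  finally have "real (card ?J) \<le> real (\<Sum>T\<in>Outs. card (B T))" by (rule of_nat_mono)
  hence "real (card ?J) \<le> (\<Sum>T\<in>Outs. real (card (B T)))" by (simp only: of_nat_sum)
  also have "\<dots> \<le> (\<Sum>T\<in>Outs. b)"
  proof (intro sum_mono)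
    fix T
    have "(2 * c - 1) * ((real n)\<^sup>2 - 1) \<ge> 0" using assms(1,3) by simp
    from card_correlated_le[OF assms(3) this, of T] show "real (card (B T)) \<le> b"
      unfolding B_def b_def .
  qed
  also have "\<dots> = real (card Outs) * b" by simp
  also have "\<dots> \<le> real ((n\<^sup>2 + 1) ^ q) * b"
    using Outs(2) by (intro mult_right_mono of_nat_mono) (simp_all add: b_def)
  finally show ?thesis using le I by (simp add: b_def add.commute)
qed

section \<open>Taking logarithms and asymptotics\<close>

text \<open>Collects the lower-order terms of the logarithmic inequality, divided by
  \<open>3 * n\<close> so that the main term becomes \<open>(2 * c - 1) / 6\<close>. The summand
  \<open>(2 * c - 1) / 2\<close> comes from replacing \<open>n\<close> by \<open>n - 1\<close> in
  the Chernoff exponent.\<close>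

definition error_term :: "real \<Rightarrow> real \<Rightarrow> nat \<Rightarrow> real" where
  "error_term c p n = (ln (2 * (real n + 1)) - ln p + (2 * c - 1) / 2) / (3 * real n)"

lemma error_term_tendsto: "error_term c p \<longlonglongrightarrow> 0"
  unfolding error_term_def by real_asymp

lemma query_lower_bound:
  assumes "c > 1 / 2" "p > 0" "n \<ge> 2" "\<And>S. bipartite_graph S \<in> \<G>"
    and "randomized_alg n A" and finds: "finds_cut \<G> n c p A" and "makes_at_most \<G> n A q"
  shows "real q \<ge> real n / ln (real n) * (p * (2 * c - 1) / (16 * c + 72) - error_term c p n)"
proof -
  interpret prob_space A using assms by (simp add: randomized_alg_def)
  define e where "e = (2 * c - 1) * ((real n)\<^sup>2 - 1) / (2 * real n)"
  define L where "L = ln (real n)"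
  have n: "real n \<ge> 2" "L > 0" using assms by (auto simp: L_def)
  have "p \<le> 1"
    using finds assms(4)[of "{}"] prob_le_1 unfolding finds_cut_def by (meson order_trans)
  have "p * 2 ^ n \<le> (real n + 1) * (p * real (n choose (n div 2)))"
  proof -
    have "real (2 ^ n) \<le> real ((n + 1) * (n choose (n div 2)))"
      using central_binomial_ge by (intro of_nat_mono)
    hence "p * 2 ^ n \<le> p * ((real n + 1) * real (n choose (n div 2)))"
      using assms(2) by (intro mult_left_mono) (simp_all add: algebra_simps)
    thus ?thesis by (simp add: mult_ac)
  qed
  also have "\<dots> \<le> (real n + 1) * ((real n ^ 2 + 1) ^ q * (2 * 2 ^ n * exp (- e)))"
    using success_bound[of c p n \<G> A q] assms by (intro mult_left_mono) (auto simp: e_def)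
  finally have "2 ^ n * p \<le> 2 ^ n * ((real n ^ 2 + 1) ^ q * (2 * (real n + 1)) * exp (- e))"
    by (simp only: mult_ac)
  hence "p \<le> (real n ^ 2 + 1) ^ q * (2 * (real n + 1)) * exp (- e)"
    by (rule mult_left_le_imp_le) simp
  hence "ln p \<le> ln ((real n ^ 2 + 1) ^ q * (2 * (real n + 1)) * exp (- e))"
    using assms by (subst ln_le_cancel_iff) (auto intro!: mult_pos_pos add_pos_pos zero_less_power)
  also have "\<dots> = real q * ln (real n ^ 2 + 1) + ln (2 * (real n + 1)) - e"
  proof -
    have "real n ^ 2 + 1 > 0" by (simp add: add_nonneg_pos)
    thus ?thesis using n by (simp add: ln_mult_pos ln_realpow)
  qed
  \<comment> \<open>For \<open>n \<ge> 2\<close>, \<open>n^2 + 1 \<le> n^3\<close>, so one answer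
    carries at most \<open>3 * ln n\<close> of information.\<close>
  also have "\<dots> \<le> real q * (3 * L) + ln (2 * (real n + 1)) - e"
  proof -
    have "2 * (real n)\<^sup>2 \<le> real n * (real n)\<^sup>2" using n by (intro mult_right_mono) auto
    moreover have "1 \<le> (real n)\<^sup>2" using n by simp
    ultimately have "real n ^ 2 + 1 \<le> real n ^ 3" by (simp add: power3_eq_cube power2_eq_square)
    hence "ln (real n ^ 2 + 1) \<le> ln (real n ^ 3)"
      using n by (subst ln_le_cancel_iff) (auto intro: add_nonneg_pos)
    also have "\<dots> = 3 * L" using n by (simp add: ln_realpow L_def)
    finally have "ln (real n ^ 2 + 1) \<le> 3 * L" .
    thus ?thesis by (simp add: mult_left_mono)
  qed
  finally have q: "e - ln (2 * (real n + 1)) + ln p \<le> 3 * (real q * L)" by simp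
  have "e \<ge> (2 * c - 1) * (real n - 1) / 2"
  proof -
    have "(real n - 1) * real n \<le> (real n)\<^sup>2 - 1" using n by (simp add: algebra_simps power2_eq_square)
    hence "(2 * c - 1) * ((real n - 1) * real n) \<le> (2 * c - 1) * ((real n)\<^sup>2 - 1)"
      using assms by (intro mult_left_mono) auto
    thus ?thesis using n unfolding e_def by (simp add: field_simps)
  qed
  with q have "(2 * c - 1) * (real n - 1) / 2 - ln (2 * (real n + 1)) + ln p \<le> 3 * (real q * L)"
    by linarith
  moreover have "(2 * c - 1) * (real n - 1) / 2 - ln (2 * (real n + 1)) + ln p
      = 3 * (real n * ((2 * c - 1) / 6 - error_term c p n))"
    using n by (simp add: error_term_def field_simps)
  ultimately have "real n * ((2 * c - 1) / 6 - error_term c p n) \<le> real q * L" by simp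
  \<comment> \<open>Weakens the constant to the claimed one, using \<open>p \<le> 1\<close> and
    \<open>16 * c + 72 \<ge> 6\<close>.\<close>
  moreover have "real n * (p * (2 * c - 1) / (16 * c + 72) - error_term c p n)
      \<le> real n * ((2 * c - 1) / 6 - error_term c p n)"
  proof -
    have "p * (2 * c - 1) / (16 * c + 72) \<le> 1 * (2 * c - 1) / 6"
      using assms \<open>p \<le> 1\<close> by (intro frac_le mult_right_mono) auto
    thus ?thesis by (intro mult_left_mono) auto
  qed
  ultimately have "real n * (p * (2 * c - 1) / (16 * c + 72) - error_term c p n) \<le> real q * L"
    by linarith
  thus ?thesis using n by (simp add: field_simps flip: L_def)
qed

text \<open>A finite infimum in \<open>enat\<close> is attained; the empty set gives infinity, where
  the bound is trivial.\<close>

lemma ereal_le_Inf_enat: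
  assumes "\<And>q. enat q \<in> S \<Longrightarrow> r \<le> real q"
  shows "ereal r \<le> ereal_of_enat (Inf S)"
proof (cases "Inf S")
  case (enat q)
  hence "S \<noteq> {}" by (auto simp: Inf_enat_def)
  hence "Inf S \<in> S" using wellorder_InfI by blast
  thus ?thesis using assms enat by simp
qed simp

theorem theoremB1:
  fixes c p :: real
  assumes "c > 1 / 2" and "p > 0"
  shows "\<forall>\<G>\<in>{weighted_graphs, unweighted_graphs}.
      (\<exists>\<epsilon> :: nat \<Rightarrow> real. \<epsilon> \<longlonglongrightarrow> 0 \<and>
        (\<forall>n\<ge>2. \<forall>A q. randomized_alg n A \<longrightarrow> finds_cut (\<G> n) n c p A \<longrightarrow> makes_at_most (\<G> n) n A q \<longrightarrow>
           real q \<ge> real n / ln (real n) * (p * (2 * c - 1) / (16 * c + 72) - \<epsilon> n)))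
    \<and> (\<exists>C>0. \<forall>\<^sub>F n in sequentially.
        ereal_of_enat (query_complexity (\<G> n) n c p) \<ge> ereal (C * (real n / ln (real n))))"
proof (intro ballI)
  fix \<G> assume "\<G> \<in> {weighted_graphs, unweighted_graphs}"
  \<comment> \<open>The hard instances are unweighted and hence lie in both classes, so one argument
    serves both.\<close>
  hence G: "bipartite_graph S \<in> \<G> n" for S n
    using bipartite_graph_unweighted[of S n] by (auto simp: unweighted_graphs_def)
  define K where "K = p * (2 * c - 1) / (16 * c + 72)"
  have bound: "real q \<ge> real n / ln (real n) * (K - error_term c p n)"
    if "n \<ge> 2" "randomized_alg n A" "finds_cut (\<G> n) n c p A" "makes_at_most (\<G> n) n A q" for n A q
    using query_lower_bound[OF assms that(1) G that(2-4)] by (simp only: K_def)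
  have K: "K > 0" using assms by (simp add: K_def)
  \<comment> \<open>Eventually the error takes at most half of \<open>K\<close>, which leaves the
    constant \<open>K / 2\<close>.\<close>
  have "\<forall>\<^sub>F n in sequentially. error_term c p n < K / 2"
    using K by (intro order_tendstoD(2)[OF error_term_tendsto]) simp
  hence "\<forall>\<^sub>F n in sequentially.
      ereal (K / 2 * (real n / ln (real n))) \<le> ereal_of_enat (query_complexity (\<G> n) n c p)"
    using eventually_ge_at_top[of "2 :: nat"]
  proof eventually_elim
    case (elim n)
    have "real n / ln (real n) * (K / 2) \<le> real n / ln (real n) * (K - error_term c p n)"
      using elim by (intro mult_left_mono) auto
    thus ?case
      unfolding query_complexity_def mult.commute[of "K / 2"]
      using bound[OF elim(2)] by (intro ereal_le_Inf_enat) force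
  qed
  thus "(\<exists>\<epsilon> :: nat \<Rightarrow> real. \<epsilon> \<longlonglongrightarrow> 0 \<and>
        (\<forall>n\<ge>2. \<forall>A q. randomized_alg n A \<longrightarrow> finds_cut (\<G> n) n c p A \<longrightarrow> makes_at_most (\<G> n) n A q \<longrightarrow>
           real q \<ge> real n / ln (real n) * (p * (2 * c - 1) / (16 * c + 72) - \<epsilon> n)))
    \<and> (\<exists>C>0. \<forall>\<^sub>F n in sequentially.
        ereal_of_enat (query_complexity (\<G> n) n c p) \<ge> ereal (C * (real n / ln (real n))))"
    unfolding K_def[symmetric]
    using bound error_term_tendsto K by (intro conjI exI[of _ "error_term c p"] exI[of _ "K / 2"]) auto
qed

end
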